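(* Let $\varphi_{1/2}(z)=\dfrac{1}{1-z}$ and $\varphi_{\mathbb C}(z)=z+\sqrt{1+z^2}$ (principal branch of the square root) for $z\in\mathbb D$. Then $$R_{\mathcal S^*(\varphi_{\mathbb C})}(\mathcal S^*(\varphi_{1/2}))=2-\sqrt2.$$
   Context: Let $\mathbb D=\{z\in\mathbb C:|z|<1\}$ and let $\mathcal A$ be the class of functions $f$ analytic on $\mathbb D$ with $f(0)=0$ and $f'(0)=1$. For an analytic function $\varphi$ on $\mathbb D$ with $\varphi(0)=1$, the class $\mathcal S^*(\varphi)$ consists of all $f\in\mathcal A$ with $zf'(z)/f(z)\prec\varphi(z)$; that is, there is an analytic $\omega:\mathbb D\to\mathbb D$ with $\omega(0)=0$ such that $zf'(z)/f(z)=\varphi(\omega(z))$ on $\mathbb D$ (the quotient takes the value $1$ at $z=0$, and $f$ has no other zeros). For two such functions $\varphi_1,\varphi_2$, the sharp $\mathcal S^*(\varphi_2)$-radius of $\mathcal S^*(\varphi_1)$ is $$R_{\mathcal S^*(\varphi_2)}(\mathcal S^*(\varphi_1))=\sup\left\{r\in(0,1]: f_r(z)=\tfrac{f(rz)}{r}\text{ belongs to }\mathcal S^*(\varphi_2)\text{ for every } f\in\mathcal S^*(\varphi_1)\right\}.$$ *)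

theory Defs
  imports "HOL-Complex_Analysis.Complex_Analysis"
begin

definition class_A :: "(complex \<Rightarrow> complex) set" where
  "class_A = {f. f holomorphic_on ball 0 1 \<and> f 0 = 0 \<and> deriv f 0 = 1}"

text \<open>Subordination through a Schwarz function on the unit disk.\<close>

definition subordinate :: "(complex \<Rightarrow> complex) \<Rightarrow> (complex \<Rightarrow> complex) \<Rightarrow> bool" where
  "subordinate g \<phi> \<longleftrightarrow>
     (\<exists>\<omega>. \<omega> holomorphic_on ball 0 1 \<and> \<omega> ` ball 0 1 \<subseteq> ball 0 1 \<and> \<omega> 0 = 0 \<and>
          (\<forall>z\<in>ball 0 1. g z = \<phi> (\<omega> z)))"

text \<open>The singularity of \<open>z f'(z) / f(z)\<close> at the origin is removable for \<open>f\<close> in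
  \<open>class_A\<close>, with value 1; in HOL the bare quotient would be 0 there.\<close>

definition starlike_quotient :: "(complex \<Rightarrow> complex) \<Rightarrow> complex \<Rightarrow> complex" where
  "starlike_quotient f z = (if z = 0 then 1 else z * deriv f z / f z)"

text \<open>The Ma--Minda class of \<open>\<phi>\<close>, meant for \<open>\<phi>\<close> holomorphic on the unit disk with
  \<open>\<phi> 0 = 1\<close>. Nonvanishing of \<open>f\<close> off the origin is stated explicitly,
  because HOL division is total.\<close>

definition starlike_class :: "(complex \<Rightarrow> complex) \<Rightarrow> (complex \<Rightarrow> complex) set" where
  "starlike_class \<phi> =
     {f \<in> class_A. (\<forall>z\<in>ball 0 1 - {0}. f z \<noteq> 0) \<and> subordinate (starlike_quotient f) \<phi>}"

text \<open>\<open>starlike_radius \<phi>\<^sub>2 \<phi>\<^sub>1\<close> is the sharp radius of the class of \<open>\<phi>\<^sub>1\<close> with respect to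
  the class of \<open>\<phi>\<^sub>2\<close>.\<close>

definition starlike_radius ::
  "(complex \<Rightarrow> complex) \<Rightarrow> (complex \<Rightarrow> complex) \<Rightarrow> real" where
  "starlike_radius \<phi>\<^sub>2 \<phi>\<^sub>1 =
     Sup {r :: real. 0 < r \<and> r \<le> 1 \<and>
       (\<forall>f\<in>starlike_class \<phi>\<^sub>1. (\<lambda>z. f (of_real r * z) / of_real r) \<in> starlike_class \<phi>\<^sub>2)}"

definition phi_half :: "complex \<Rightarrow> complex" where
  "phi_half z = 1 / (1 - z)"

definition phi_crescent :: "complex \<Rightarrow> complex" where
  "phi_crescent z = z + csqrt (1 + z\<^sup>2)"

end

theory Submission imports Defs
begin

text \<open>The map \<open>w \<mapsto> (w - 1/w) / 2\<close> inverts \<^const>\<open>phi_crescent\<close>, and it sends \<open>w = 1/(1 - u)\<close> to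
  \<open>v = (u + u/(1 - u)) / 2\<close>. Since \<open>v\<close> has nonnegative Taylor coefficients in \<open>u\<close>, its modulus
  on \<open>\<bar>u\<bar> < r\<close> is less than its value at \<open>u = r\<close>, which is 1 precisely for \<open>r = 2 - \<surd>2\<close>.
  The function \<open>z/(1 - z)\<close>, for which \<open>\<omega>\<close> is the identity, shows sharpness.\<close>

definition transfer :: "complex \<Rightarrow> complex" where
  "transfer u = (u + u / (1 - u)) / 2"

text \<open>With w = 1/(1 - u), \<open>transfer u\<close> is (w - 1/w)/2, and 1 plus its square is
  the square of s = (w + 1/w)/2. Both w and 1/w have positive real part, so the principal root
  returns s and not -s, and the sum is w.\<close>

lemma phi_crescent_transfer:
  assumes "norm u < 1"
  shows "phi_crescent (transfer u) = phi_half u"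
proof -
  have re: "Re (1 - u) > 0"
    using complex_Re_le_cmod[of u] assms by simp
  then have ne: "1 - u \<noteq> 0" by (metis less_irrefl zero_complex.simps(1))
  define s where "s = (1 / (1 - u) + (1 - u)) / 2"
  have "Re (1 / (1 - u)) > 0"
    using re by (auto simp: Re_divide power2_eq_square intro!: divide_pos_pos add_pos_nonneg)
  then have "Re s > 0" using re by (simp add: s_def)
  then have "csqrt (s\<^sup>2) = s" by (intro csqrt_square) auto
  moreover have "1 + (transfer u)\<^sup>2 = s\<^sup>2" "transfer u + s = 1 / (1 - u)"
    using ne by (simp_all add: transfer_def s_def divide_simps) algebra+
  ultimately show ?thesis by (simp add: phi_crescent_def phi_half_def)
qed

text \<open>The left inequality is t + t/(1 - t) < 2 with the denominator cleared. It rearranges to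
  (2 - t)^2 > 2, where 2 - t is positive. The upper and the lower bound on the radius use opposite
  directions.\<close>

lemma crescent_threshold:
  fixes t :: real
  assumes "t < 1"
  shows "t * (2 - t) < 2 * (1 - t) \<longleftrightarrow> t < 2 - sqrt 2"
proof -
  have "2 * (1 - t) \<le> t * (2 - t) \<longleftrightarrow> (2 - t)\<^sup>2 \<le> (sqrt 2)\<^sup>2"
    by (simp add: power2_eq_square algebra_simps)
  also have "\<dots> \<longleftrightarrow> 2 - t \<le> sqrt 2"
    using assms by (subst abs_le_square_iff[symmetric]) auto
  finally show ?thesis by linarith
qed

lemma norm_transfer_less_1:
  assumes "norm u < 2 - sqrt 2"
  shows "norm (transfer u) < 1"
proof -
  define t where "t = norm u"
  have t: "0 \<le> t" "t < 1" "t < 2 - sqrt 2"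
    using assms real_sqrt_ge_one[of 2] norm_ge_zero[of u] unfolding t_def by linarith+
  \<comment> \<open>The triangle inequality replaces the comparison of Taylor coefficients: each
    summand is bounded by its value at t.\<close>
  have "1 - t \<le> norm (1 - u)"
    using norm_triangle_ineq2[of 1 u] by (simp add: t_def)
  then have "norm (u / (1 - u)) \<le> t / (1 - t)"
    using t by (simp add: norm_divide t_def frac_le)
  then have "norm (u + u / (1 - u)) \<le> t + t / (1 - t)"
    using norm_triangle_ineq[of u "u / (1 - u)"] by (simp add: t_def)
  also have "\<dots> < 2"
    using t crescent_threshold[of t] by (simp add: field_simps)
  finally show ?thesis by (simp add: transfer_def norm_divide)
qed

lemma transfer_holomorphic: "transfer holomorphic_on ball 0 1"
  unfolding transfer_def by (intro holomorphic_intros) auto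

lemma norm_scaled_less:
  fixes z :: complex
  assumes "0 < r" "norm z < 1"
  shows "norm (of_real r * z) < r"
  using assms by (simp add: norm_mult)

lemma deriv_rescale:
  assumes "f holomorphic_on ball 0 1" "0 < r" "r \<le> 1" "norm z < 1"
  shows "deriv (\<lambda>z. f (of_real r * z) / of_real r) z = deriv f (of_real r * z)"
proof -
  have "of_real r * z \<in> ball 0 1"
    using norm_scaled_less[of r z] assms by auto
  then have "(f has_field_derivative deriv f (of_real r * z)) (at (of_real r * z))"
    using assms(1) holomorphic_derivI open_ball by blast
  then have "((\<lambda>z. f (of_real r * z) / of_real r) has_field_derivative
      deriv f (of_real r * z) * of_real r / of_real r) (at z)"
    by (intro DERIV_cdivide DERIV_chain2[where f = f]) (auto intro!: derivative_eq_intros)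
  then show ?thesis using assms(2) by (intro DERIV_imp_deriv) simp
qed

lemma class_A_rescale:
  assumes "f \<in> class_A" "0 < r" "r \<le> 1"
  shows "(\<lambda>z. f (of_real r * z) / of_real r) \<in> class_A"
proof -
  have hol: "f holomorphic_on ball 0 1" and "f 0 = 0" "deriv f 0 = 1"
    using assms(1) by (auto simp: class_A_def)
  moreover have "(f \<circ> (\<lambda>z. of_real r * z)) holomorphic_on ball 0 1"
    using norm_scaled_less[of r] assms
    by (intro holomorphic_on_compose_gen[OF _ hol] holomorphic_intros) force
  ultimately show ?thesis
    using deriv_rescale[OF hol assms(2,3), of 0] assms(2)
    by (auto simp: class_A_def o_def intro!: holomorphic_intros)
qed

lemma starlike_quotient_rescale:
  assumes "f holomorphic_on ball 0 1" "0 < r" "r \<le> 1" "norm z < 1"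
  shows "starlike_quotient (\<lambda>z. f (of_real r * z) / of_real r) z
       = starlike_quotient f (of_real r * z)"
  using deriv_rescale[OF assms] assms(2) by (simp add: starlike_quotient_def)

text \<open>If \<omega> is a Schwarz function for f, then z \<mapsto>
  \<open>transfer (\<omega> (r * z))\<close> is one for the rescaled function.\<close>

lemma rescale_in_crescent:
  assumes f: "f \<in> starlike_class phi_half" and r: "0 < r" "r \<le> 2 - sqrt 2"
  shows "(\<lambda>z. f (of_real r * z) / of_real r) \<in> starlike_class phi_crescent"
proof -
  have r1: "r \<le> 1" using r real_sqrt_ge_one[of 2] by linarith
  have fA: "f \<in> class_A" and hol: "f holomorphic_on ball 0 1"
    and nz: "\<And>z. norm z < 1 \<Longrightarrow> z \<noteq> 0 \<Longrightarrow> f z \<noteq> 0"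
    using f by (auto simp: starlike_class_def class_A_def)
  obtain \<omega> where \<omega>: "\<omega> holomorphic_on ball 0 1" "\<omega> ` ball 0 1 \<subseteq> ball 0 1" "\<omega> 0 = 0"
    and q: "\<And>z. norm z < 1 \<Longrightarrow> starlike_quotient f z = phi_half (\<omega> z)"
    using f by (auto simp: starlike_class_def subordinate_def)
  have small: "norm (of_real r * z) < 1" if "norm z < 1" for z :: complex
    using norm_scaled_less[OF r(1) that] r1 by linarith
  have schwarz: "norm (\<omega> (of_real r * z)) < r" if "norm z < 1" for z
  proof -
    have "norm (\<omega> (of_real r * z)) \<le> norm (of_real r * z)"
      by (rule Schwarz_Lemma(1)) (use \<omega> small[OF that] in \<open>auto simp: image_subset_iff\<close>)
    then show ?thesis using norm_scaled_less[OF r(1) that] by linarith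
  qed
  have "(\<omega> \<circ> (\<lambda>z. of_real r * z)) holomorphic_on ball 0 1"
    using small by (intro holomorphic_on_compose_gen[OF _ \<omega>(1)] holomorphic_intros) auto
  then have "(transfer \<circ> (\<omega> \<circ> (\<lambda>z. of_real r * z))) holomorphic_on ball 0 1"
    by (rule holomorphic_on_compose_gen[OF _ transfer_holomorphic])
      (use schwarz r1 in force)
  moreover have "norm (transfer (\<omega> (of_real r * z))) < 1" if "norm z < 1" for z
    using norm_transfer_less_1 schwarz[OF that] r by simp
  moreover have "starlike_quotient (\<lambda>z. f (of_real r * z) / of_real r) z
      = phi_crescent (transfer (\<omega> (of_real r * z)))" if "norm z < 1" for z
    using starlike_quotient_rescale[OF hol r(1) r1 that] q[OF small[OF that]]
      phi_crescent_transfer[of "\<omega> (of_real r * z)"] schwarz[OF that] r1 by simp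
  ultimately have "subordinate (starlike_quotient (\<lambda>z. f (of_real r * z) / of_real r)) phi_crescent"
    unfolding subordinate_def using \<omega>(3)
    by (intro exI[of _ "transfer \<circ> (\<omega> \<circ> (\<lambda>z. of_real r * z))"]) (auto simp: transfer_def)
  then show ?thesis
    using class_A_rescale[OF fA r(1) r1] nz small r(1) by (auto simp: starlike_class_def)
qed

lemma starlike_extremal:
  defines "k \<equiv> \<lambda>z::complex. z / (1 - z)"
  shows "k \<in> starlike_class phi_half"
    and "norm z < 1 \<Longrightarrow> starlike_quotient k z = phi_half z"
proof -
  have k': "deriv k z = 1 / (1 - z)\<^sup>2" if "norm z < 1" for z
  proof -
    have "z \<noteq> 1" using that by auto
    then show ?thesis unfolding k_def
      by (intro DERIV_imp_deriv)
        (auto intro!: derivative_eq_intros simp: power2_eq_square divide_simps)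
  qed
  show q: "starlike_quotient k z = phi_half z" if "norm z < 1" for z
    using that k'[OF that]
    by (auto simp: starlike_quotient_def k_def phi_half_def power2_eq_square divide_simps)
  have "k holomorphic_on ball 0 1"
    unfolding k_def by (intro holomorphic_intros) auto
  then have "k \<in> class_A" using k'[of 0] by (simp add: class_A_def k_def)
  moreover have "subordinate (starlike_quotient k) phi_half"
    unfolding subordinate_def using q by (intro exI[of _ "\<lambda>z. z"]) auto
  ultimately show "k \<in> starlike_class phi_half"
    by (auto simp: starlike_class_def k_def)
qed

text \<open>The value w = \<open>phi_crescent v\<close> is a root of w^2 - 2 v w - 1 = 0, so w^2 - 1
  = 2 v w, and \<open>norm v < 1\<close> gives the bound, strict because w is nonzero.\<close>

lemma phi_crescent_image:
  assumes "norm v < 1"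
  shows "norm ((phi_crescent v)\<^sup>2 - 1) < 2 * norm (phi_crescent v)"
proof -
  have c: "(csqrt (1 + v\<^sup>2))\<^sup>2 = 1 + v\<^sup>2" by simp
  then have "(phi_crescent v)\<^sup>2 - 1 = 2 * v * phi_crescent v"
    unfolding phi_crescent_def by algebra
  moreover have "phi_crescent v \<noteq> 0"
  proof
    assume "phi_crescent v = 0"
    then have "csqrt (1 + v\<^sup>2) = - v" by (simp add: phi_crescent_def add_eq_0_iff)
    with c have "(- v)\<^sup>2 = 1 + v\<^sup>2" by metis
    then show False by simp
  qed
  ultimately show ?thesis using assms by (simp add: norm_mult)
qed

lemma radius_upper_bound:
  assumes r: "0 < r" "r \<le> 1"
    and all: "\<And>f. f \<in> starlike_class phi_half \<Longrightarrow>
      (\<lambda>z. f (of_real r * z) / of_real r) \<in> starlike_class phi_crescent"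
  shows "r \<le> 2 - sqrt 2"
\<comment> \<open>The point r itself would correspond to z = 1 on the boundary of the disk, so every
  t < r is tested instead, at the interior point z = t/r, where r z = t.\<close>
proof (rule dense_le_bounded[OF r(1)])
  fix t :: real
  assume t: "0 < t" "t < r"
  define k where "k = (\<lambda>z::complex. z / (1 - z))"
  define z where "z = complex_of_real (t / r)"
  have z: "norm z < 1" "of_real r * z = of_real t"
    using t by (auto simp: z_def norm_divide)
  have k: "k \<in> starlike_class phi_half"
    "\<And>z. norm z < 1 \<Longrightarrow> starlike_quotient k z = phi_half z"
    using starlike_extremal by (auto simp: k_def)
  then have hol: "k holomorphic_on ball 0 1" by (auto simp: starlike_class_def class_A_def)
  obtain \<omega> where "\<omega> ` ball 0 1 \<subseteq> ball 0 1"
    "\<And>z. z \<in> ball 0 1 \<Longrightarrow>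
      starlike_quotient (\<lambda>z. k (of_real r * z) / of_real r) z = phi_crescent (\<omega> z)"
    using all[OF k(1)] unfolding starlike_class_def subordinate_def by blast
  then obtain v where v: "norm v < 1"
    "starlike_quotient (\<lambda>z. k (of_real r * z) / of_real r) z = phi_crescent v"
    using z(1) by (metis image_subset_iff mem_ball_0)
  have "phi_crescent v = of_real (1 / (1 - t))"
    using starlike_quotient_rescale[OF hol r z(1)] v(2) k(2)[of "of_real t"] z(2) t r
    by (simp add: phi_half_def)
  then have "norm (complex_of_real ((1 / (1 - t))\<^sup>2 - 1)) < 2 * norm (complex_of_real (1 / (1 - t)))"
    using phi_crescent_image[OF v(1)] by simp
  then have "(1 / (1 - t))\<^sup>2 - 1 < 2 * (1 / (1 - t))"
    unfolding norm_of_real using t r by simp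
  \<comment> \<open>Multiply by (1 - t)^2 and use 1 - (1 - t)^2 = t (2 - t).\<close>
  then have "t * (2 - t) < 2 * (1 - t)"
    using t r by (simp add: divide_simps power2_eq_square split: if_splits) (simp add: algebra_simps)
  then show "t \<le> 2 - sqrt 2" using crescent_threshold t r by simp
qed

theorem theorem7p14: "starlike_radius phi_crescent phi_half = 2 - sqrt 2"
  unfolding starlike_radius_def
\<comment> \<open>The supremum is attained: 2 - sqrt 2 is itself an admissible radius.\<close>
proof (rule cSup_eq_maximum)
  have "0 < 2 - sqrt 2" "2 - sqrt 2 \<le> 1"
    using real_sqrt_less_mono[of 2 4] real_sqrt_ge_one[of 2] by auto
  then show "2 - sqrt 2 \<in> {r. 0 < r \<and> r \<le> 1 \<and> (\<forall>f\<in>starlike_class phi_half.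
      (\<lambda>z. f (of_real r * z) / of_real r) \<in> starlike_class phi_crescent)}"
    using rescale_in_crescent by blast
qed (use radius_upper_bound in blast)

end
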